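(* Let $G$ be a locally compact Polish group. Then every $\gamma$-set $X\subseteq G$ is sharply $\mathcal M$-additive in $G$.
   Context: A Polish group is a topological group whose topology is separable and completely metrizable. A set is meager if it is a countable union of nowhere dense sets. A set $X\subseteq G$ is sharply $\mathcal M$-additive if for every meager set $M\subseteq G$ there is a $\sigma$-compact set $K\supseteq X$ such that $MK=\{mk:m\in M,k\in K\}$ is meager. A family $\mathcal U$ of open sets in a separable metric space $X$ is an $\omega$-cover of $X$ if every finite subset of $X$ is contained in some $U\in\mathcal U$. A sequence $\langle U_n:n\in\omega\rangle$ of subsets of $X$ is a $\gamma$-cover of $X$ if each $x\in X$ belongs to all but finitely many $U_n$. A separable metric space $X$ is a $\gamma$-set if every $\omega$-cover of $X$ contains a $\gamma$-cover, i.e. there is a sequence of members of the $\omega$-cover that is a $\gamma$-cover of $X$. A subset of $G$ is a $\gamma$-set if it is so as a subspace. *)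

theory Defs
  imports "HOL-Analysis.Analysis" "HOL-Library.Set_Algebras"
begin

(* Groups are written additively, as in the library's class topological_group_add, which is
   built on group_add and does not assume commutativity.  A Polish group is then a type of sort
   {topological_group_add, polish_space}.  The class polish_space fixes one complete metric
   inducing the topology; no compatibility of this metric with the group operation is assumed,
   and every notion below depends on the topology only. *)

definition nowhere_dense :: "'a::topological_space set \<Rightarrow> bool" where
  "nowhere_dense S \<longleftrightarrow> interior (closure S) = {}"

definition meager :: "'a::topological_space set \<Rightarrow> bool" where
  "meager M \<longleftrightarrow> (\<exists>N :: nat \<Rightarrow> 'a set. (\<forall>n. nowhere_dense (N n)) \<and> M = (\<Union>n. N n))"

definition sigma_compact :: "'a::topological_space set \<Rightarrow> bool" where
  "sigma_compact K \<longleftrightarrow> (\<exists>C :: nat \<Rightarrow> 'a set. (\<forall>n. compact (C n)) \<and> K = (\<Union>n. C n))"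

(* M + K is the elementwise sum {m + k | m k. m : M & k : K} of Set_Algebras, i.e. the product
   set MK with the meager factor on the left. *)

definition sharply_meager_additive :: "'a::topological_group_add set \<Rightarrow> bool" where
  "sharply_meager_additive X \<longleftrightarrow>
     (\<forall>M. meager M \<longrightarrow> (\<exists>K. sigma_compact K \<and> X \<subseteq> K \<and> meager (M + K)))"

(* The covering notions are those of the subspace X, so covers consist of relatively open
   subsets of X.  As X itself may be a member, an omega-cover need not be proper. *)

definition omega_cover :: "'a::topological_space set \<Rightarrow> 'a set set \<Rightarrow> bool" where
  "omega_cover X \<U> \<longleftrightarrow>
     (\<forall>U\<in>\<U>. openin (top_of_set X) U) \<and>
     (\<forall>F. finite F \<and> F \<subseteq> X \<longrightarrow> (\<exists>U\<in>\<U>. F \<subseteq> U))"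

definition gamma_cover :: "'a set \<Rightarrow> (nat \<Rightarrow> 'a set) \<Rightarrow> bool" where
  "gamma_cover X U \<longleftrightarrow>
     (\<forall>n. U n \<subseteq> X) \<and> (\<forall>x\<in>X. \<forall>\<^sub>F n in sequentially. x \<in> U n)"

(* The sort makes every subspace X separable and metrizable. *)

definition gamma_set :: "'a::{metric_space, second_countable_topology} set \<Rightarrow> bool" where
  "gamma_set X \<longleftrightarrow>
     (\<forall>\<U>. omega_cover X \<U> \<longrightarrow> (\<exists>U. range U \<subseteq> \<U> \<and> gamma_cover X U))"

end

theory Submission
  imports Defs
begin

text \<open>
  Cover \<open>M\<close> by closed sets \<open>N 0, N 1, \<dots>\<close> with empty interior and let \<open>B 0, B 1, \<dots>\<close> be a base
  of nonempty open sets.  A set \<open>N j + K\<close> has empty interior as soon as it omits a point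
  of every \<open>B i\<close>, so the required smallness of \<open>K\<close> splits into countably many conditions
  \<open>\<not> B i \<subseteq> N j + K\<close>.  Any finite number of them holds for the closure of some open neighbourhood
  of a given finite set \<open>F\<close>: first, \<open>N j + F\<close> has empty interior, and second, a point
  \<open>p \<notin> N j + F\<close> stays outside when \<open>F\<close> is slightly enlarged, because \<open>{x. p - x \<in> N j}\<close> is a
  closed set disjoint from \<open>F\<close>.

  Hence, for each \<open>n\<close>, every finite subset of \<open>X\<close> lies in an open set whose closure meets the
  first \<open>n\<close> conditions.  If \<open>X\<close> is infinite, the selection principle for \<open>\<gamma>\<close>-sets
  (\<open>gamma_set_selection\<close>) yields open sets \<open>V k\<close> such that each point of \<open>X\<close> is in
  almost all \<open>V k\<close> and each condition is met by the closures of almost all \<open>V k\<close>.  The closed sets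
  \<open>\<Inter>k\<in>{n..}. closure (V k)\<close> then cover \<open>X\<close> and meet all conditions at once.  For finite \<open>X\<close> the set
  \<open>K = X\<close> itself will do.

  Local compactness enters through \<open>\<sigma>\<close>-compactness of the group: cutting these closed sets with
  compact ones makes them compact, and the sum of a closed and a compact set is closed
  (\<open>closed_set_plus_compact\<close>), so that empty interior becomes nowhere density.
\<close>


section \<open>Meager sets and sums of sets\<close>

lemma meager_iff_subset_closed:
  "meager M \<longleftrightarrow>
     (\<exists>N :: nat \<Rightarrow> 'a::topological_space set.
        (\<forall>n. closed (N n) \<and> interior (N n) = {}) \<and> M \<subseteq> (\<Union>n. N n))"
proof
  assume "meager M"
  then obtain N :: "nat \<Rightarrow> 'a set"
    where N: "\<And>n. nowhere_dense (N n)" "M = (\<Union>n. N n)"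
    unfolding meager_def by blast
  have "M \<subseteq> (\<Union>n. closure (N n))"
    using N(2) closure_subset by blast
  then show "\<exists>N :: nat \<Rightarrow> 'a set.
      (\<forall>n. closed (N n) \<and> interior (N n) = {}) \<and> M \<subseteq> (\<Union>n. N n)"
    using N(1) unfolding nowhere_dense_def by (intro exI[of _ "\<lambda>n. closure (N n)"]) simp
next
  assume "\<exists>N :: nat \<Rightarrow> 'a set.
      (\<forall>n. closed (N n) \<and> interior (N n) = {}) \<and> M \<subseteq> (\<Union>n. N n)"
  then obtain N :: "nat \<Rightarrow> 'a set"
    where N: "\<And>n. closed (N n)" "\<And>n. interior (N n) = {}" "M \<subseteq> (\<Union>n. N n)"
    by blast
  have "nowhere_dense (N n \<inter> M)" for n
    using interior_mono[OF closure_minimal[OF Int_lower1 N(1)], of n M] N(2)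
    unfolding nowhere_dense_def by auto
  moreover have "M = (\<Union>n. N n \<inter> M)"
    using N(3) by blast
  ultimately show "meager M"
    unfolding meager_def by (intro exI[of _ "\<lambda>n. N n \<inter> M"]) simp
qed

lemma closed_set_plus_compact:
  fixes N K :: "'a::{topological_group_add, metric_space} set"
  assumes "closed N" and "compact K"
  shows "closed (N + K)"
  unfolding closed_sequential_limits
proof (intro allI impI, elim conjE)
  fix s l
  assume "\<forall>n. s n \<in> N + K" and lim: "s \<longlonglongrightarrow> l"
  then have "\<forall>n. \<exists>x\<in>K. s n - x \<in> N"
    by (metis add_diff_cancel set_plus_elim)
  then obtain c where c: "\<And>n. c n \<in> K" "\<And>n. s n - c n \<in> N"
    by metis
  then obtain x r where x: "x \<in> K" and r: "strict_mono (r :: nat \<Rightarrow> nat)" "(c \<circ> r) \<longlonglongrightarrow> x"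
    using \<open>compact K\<close> unfolding compact_def by metis
  have "(\<lambda>n. (s \<circ> r) n - (c \<circ> r) n) \<longlonglongrightarrow> l - x"
    by (intro tendsto_diff r(2) LIMSEQ_subseq_LIMSEQ[OF lim r(1)])
  then have "l - x \<in> N"
    by (rule closed_sequentially[OF \<open>closed N\<close>, rotated]) (simp add: c(2))
  then have "(l - x) + x \<in> N + K"
    using x by (rule set_plus_intro)
  then show "l \<in> N + K"
    by simp
qed

lemma interior_plus_singleton_empty:
  fixes N :: "'a::topological_group_add set"
  assumes "interior N = {}"
  shows "interior (N + {x}) = {}"
proof -
  have "open ((\<lambda>y. y + x) -` interior (N + {x}))"
    by (intro open_vimage open_interior continuous_intros)
  moreover have "(\<lambda>y. y + x) -` interior (N + {x}) \<subseteq> N"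
  proof
    fix y assume "y \<in> (\<lambda>y. y + x) -` interior (N + {x})"
    then have "y + x \<in> N + {x}"
      using interior_subset by blast
    then show "y \<in> N"
      by (auto elim: set_plus_elim)
  qed
  ultimately have empty: "(\<lambda>y. y + x) -` interior (N + {x}) = {}"
    using assms interior_maximal by blast
  have "z \<notin> interior (N + {x})" for z
  proof
    assume "z \<in> interior (N + {x})"
    then have "z - x \<in> (\<lambda>y. y + x) -` interior (N + {x})"
      by simp
    then show False
      using empty by blast
  qed
  then show ?thesis
    by blast
qed

lemma interior_plus_finite_empty:
  fixes N :: "'a::{topological_group_add, metric_space} set"
  assumes "closed N" "interior N = {}" "finite F"
  shows "interior (N + F) = {}"
  using \<open>finite F\<close>
proof (induction F)
  case empty
  then show ?case
    by (simp add: set_plus_def)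
next
  case (insert x F)
  have "N + insert x F = (N + F) \<union> (N + {x})"
    by (auto simp: set_plus_def)
  moreover have "closed (N + F)"
    using assms(1) insert.hyps(1) by (intro closed_set_plus_compact finite_imp_compact)
  ultimately show ?case
    using insert.IH interior_plus_singleton_empty[OF assms(2)]
    by (simp add: interior_closed_Un_empty_interior)
qed

lemma meager_plus_sigma_compact:
  fixes M :: "'a::{topological_group_add, metric_space} set" and N K :: "nat \<Rightarrow> 'a set"
  assumes "M \<subseteq> (\<Union>j. N j)" "\<And>j. closed (N j)" "\<And>n. compact (K n)"
    and "\<And>j n. interior (N j + K n) = {}"
  shows "meager (M + (\<Union>n. K n))"
  unfolding meager_iff_subset_closed
proof (intro exI conjI allI)
  let ?L = "\<lambda>m. N (fst (prod_decode m)) + K (snd (prod_decode m))"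
  show "closed (?L m)" and "interior (?L m) = {}" for m
    using assms by (auto intro: closed_set_plus_compact)
  show "M + (\<Union>n. K n) \<subseteq> (\<Union>m. ?L m)"
  proof
    fix z assume "z \<in> M + (\<Union>n. K n)"
    then obtain j n where "z \<in> N j + K n"
      using assms(1) by (force elim!: set_plus_elim intro: set_plus_intro)
    then have "z \<in> ?L (prod_encode (j, n))"
      by simp
    then show "z \<in> (\<Union>m. ?L m)"
      by blast
  qed
qed

lemma locally_compact_sigma_compact_UNIV:
  assumes "locally_compact_space (euclidean :: 'a::second_countable_topology topology)"
  shows "sigma_compact (UNIV :: 'a set)"
proof -
  have "\<exists>U K. open U \<and> compact K \<and> x \<in> U \<and> U \<subseteq> K" for x :: 'a
    using assms unfolding locally_compact_space_def by simp
  then obtain U C where UC: "\<And>x :: 'a. open (U x)" "\<And>x. compact (C x)" "\<And>x. x \<in> U x"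
      "\<And>x. U x \<subseteq> C x"
    by metis
  obtain \<U> where \<U>: "\<U> \<subseteq> range U" "countable \<U>" "\<Union>\<U> = \<Union>(range U)"
    using Lindelof[of "range U"] UC(1) by blast
  obtain D where D: "countable D" "\<U> = U ` D"
    using countable_subset_image[of \<U> U UNIV] \<U>(1,2) by auto
  have cover: "(\<Union>x\<in>D. C x) = UNIV"
    using \<U>(3) D(2) UC(3,4) by blast
  then have "D \<noteq> {}"
    by auto
  then have "range (from_nat_into D) = D"
    using D(1) by (rule range_from_nat_into)
  then have "UNIV = (\<Union>n. C (from_nat_into D n))"
    using cover by (metis image_image)
  then show ?thesis
    unfolding sigma_compact_def using UC(2) by blast
qed


section \<open>The selection principle for gamma-sets\<close>

text \<open>
  The Gerlits--Nagy argument.  A single \<open>\<omega>\<close>-cover is formed from all families \<open>\<V> n\<close>, where members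
  of \<open>\<V> n\<close> are marked by removal of a point \<open>x n\<close> of \<open>X\<close>.  As the points are distinct, every finite
  set avoids one of them, so this is still an \<open>\<omega>\<close>-cover.  In a \<open>\<gamma>\<close>-cover chosen
  from it, almost all members contain \<open>x n\<close>, so the mark \<open>n\<close> occurs only finitely often.
\<close>

lemma gamma_set_selection:
  fixes X :: "'a::{metric_space, second_countable_topology} set"
  assumes "gamma_set X" "infinite X"
    and op: "\<And>n V. V \<in> \<V> n \<Longrightarrow> open V"
    and cover: "\<And>n F. finite F \<Longrightarrow> F \<subseteq> X \<Longrightarrow> \<exists>V\<in>\<V> n. F \<subseteq> V"
  obtains V :: "nat \<Rightarrow> 'a set" and \<nu> :: "nat \<Rightarrow> nat"
  where "\<And>k. V k \<in> \<V> (\<nu> k)" "filterlim \<nu> at_top sequentially"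
    "\<And>x. x \<in> X \<Longrightarrow> \<forall>\<^sub>F k in sequentially. x \<in> V k"
proof -
  obtain x :: "nat \<Rightarrow> 'a" where x: "inj x" "range x \<subseteq> X"
    using infinite_countable_subset[OF \<open>infinite X\<close>] by blast
  define \<U> where "\<U> = {X \<inter> (V - {x n}) | V n. V \<in> \<V> n}"
  have "omega_cover X \<U>"
    unfolding omega_cover_def
  proof (intro conjI ballI allI impI)
    fix U assume "U \<in> \<U>"
    then show "openin (top_of_set X) U"
      unfolding \<U>_def using op by (auto intro!: openin_open_Int open_Diff)
  next
    fix F assume F: "finite F \<and> F \<subseteq> X"
    have "\<exists>n. x n \<notin> F"
      using F range_inj_infinite[OF x(1)] finite_subset[of "range x" F] by blast
    then obtain n where "x n \<notin> F" ..
    moreover obtain V where "V \<in> \<V> n" "F \<subseteq> V"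
      using cover F by blast
    ultimately show "\<exists>U\<in>\<U>. F \<subseteq> U"
      unfolding \<U>_def using F by (intro bexI[of _ "X \<inter> (V - {x n})"]) auto
  qed
  then obtain U where U: "range U \<subseteq> \<U>" "gamma_cover X U"
    using \<open>gamma_set X\<close> unfolding gamma_set_def by blast
  have "\<forall>k. \<exists>V n. V \<in> \<V> n \<and> U k = X \<inter> (V - {x n})"
    using U(1) unfolding \<U>_def by blast
  then obtain V \<nu> where V: "\<And>k. V k \<in> \<V> (\<nu> k)" "\<And>k. U k = X \<inter> (V k - {x (\<nu> k)})"
    by metis
  have ev: "\<forall>\<^sub>F k in sequentially. y \<in> U k" if "y \<in> X" for y
    using U(2) that unfolding gamma_cover_def by blast
  show thesis
  proof
    show "V k \<in> \<V> (\<nu> k)" for k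
      by (rule V(1))
    show "\<forall>\<^sub>F k in sequentially. y \<in> V k" if "y \<in> X" for y
      using ev[OF that] by eventually_elim (simp add: V(2))
    show "filterlim \<nu> at_top sequentially"
      unfolding filterlim_at_top
    proof
      fix m
      have "\<forall>\<^sub>F k in sequentially. \<forall>n\<in>{..<m}. x n \<in> U k"
        using x(2) ev by (intro eventually_ball_finite) auto
      (* If \<nu> k = n < m, then U k would omit x n. *)
      then show "\<forall>\<^sub>F k in sequentially. m \<le> \<nu> k"
        by eventually_elim (metis V(2) DiffD2 Int_iff insertI1 lessThan_iff not_le)
    qed
  qed
qed


section \<open>Enlarging finite sets\<close>

lemma finite_subset_open_closure_avoids:
  fixes N :: "'a::{topological_group_add, metric_space} set"
  assumes "closed N" "finite F" "p \<notin> N + F"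
  obtains V where "open V" "F \<subseteq> V" "p \<notin> N + closure V"
proof -
  define D where "D = (\<lambda>x. p - x) -` N"
  have "closed D"
    unfolding D_def using assms(1) by (intro closed_vimage continuous_intros)
  have D_iff: "p \<in> N + A \<longleftrightarrow> D \<inter> A \<noteq> {}" for A
  proof
    assume "p \<in> N + A"
    then show "D \<inter> A \<noteq> {}"
      unfolding D_def by (metis Int_iff add_diff_cancel empty_iff set_plus_elim vimageI)
  next
    assume "D \<inter> A \<noteq> {}"
    then obtain a where "p - a \<in> N" "a \<in> A"
      unfolding D_def by blast
    then have "(p - a) + a \<in> N + A"
      by (rule set_plus_intro)
    then show "p \<in> N + A"
      by simp
  qed
  obtain W V where "open W" "open V" "D \<subseteq> W" "F \<subseteq> V" "W \<inter> V = {}"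
    using t4_space[of D F] \<open>closed D\<close> finite_imp_closed[OF assms(2)] assms(3) D_iff by metis
  have "W \<inter> closure V = {}"
    using \<open>W \<inter> V = {}\<close> open_Int_closure_eq_empty[OF \<open>open W\<close>] by simp
  then have "D \<inter> closure V = {}"
    using \<open>D \<subseteq> W\<close> by blast
  then have "p \<notin> N + closure V"
    by (simp add: D_iff)
  with \<open>open V\<close> \<open>F \<subseteq> V\<close> show thesis
    by (rule that)
qed

lemma finite_subset_open_not_subset_plus:
  fixes N B :: "'i \<Rightarrow> 'a::{topological_group_add, metric_space} set"
  assumes "finite I" "finite F"
    and "\<And>i. i \<in> I \<Longrightarrow> closed (N i) \<and> interior (N i) = {}"
    and "\<And>i. i \<in> I \<Longrightarrow> open (B i) \<and> B i \<noteq> {}"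
  obtains V where "open V" "F \<subseteq> V" "\<And>i. i \<in> I \<Longrightarrow> \<not> B i \<subseteq> N i + closure V"
proof -
  have "\<exists>V. open V \<and> F \<subseteq> V \<and> \<not> B i \<subseteq> N i + closure V" if i: "i \<in> I" for i
  proof -
    have "interior (N i + F) = {}"
      using assms(2) assms(3)[OF i] by (simp add: interior_plus_finite_empty)
    then have "\<not> B i \<subseteq> N i + F"
      using assms(4)[OF i] interior_maximal[of "B i" "N i + F"] by auto
    then obtain p where "p \<in> B i" and "p \<notin> N i + F"
      by blast
    obtain V where "open V" "F \<subseteq> V" "p \<notin> N i + closure V"
      using assms(2) assms(3)[OF i] \<open>p \<notin> N i + F\<close>
      by (meson finite_subset_open_closure_avoids)
    with \<open>p \<in> B i\<close> show ?thesis
      by (intro exI[of _ V]) auto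
  qed
  then obtain V where V: "\<And>i. i \<in> I \<Longrightarrow> open (V i)" "\<And>i. i \<in> I \<Longrightarrow> F \<subseteq> V i"
      "\<And>i. i \<in> I \<Longrightarrow> \<not> B i \<subseteq> N i + closure (V i)"
    by metis
  show thesis
  proof
    show "open (\<Inter>i\<in>I. V i)" and "F \<subseteq> (\<Inter>i\<in>I. V i)"
      using V(1,2) assms(1) by auto
    show "\<not> B i \<subseteq> N i + closure (\<Inter>i\<in>I. V i)" if "i \<in> I" for i
    proof -
      have "closure (\<Inter>i\<in>I. V i) \<subseteq> closure (V i)"
        using that by (intro closure_mono) blast
      then have "N i + closure (\<Inter>i\<in>I. V i) \<subseteq> N i + closure (V i)"
        by (rule set_plus_mono2[OF order_refl])
      then show ?thesis
        using V(3)[OF that] by (meson order_trans)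
    qed
  qed
qed


section \<open>Gamma-sets are sharply meager-additive\<close>

theorem proposition6p8:
  fixes X :: "'a::{topological_group_add, polish_space} set"
  assumes "locally_compact_space (euclidean :: 'a topology)"
    and "gamma_set X"
  shows "sharply_meager_additive X"
  unfolding sharply_meager_additive_def
proof (intro allI impI)
  fix M :: "'a set"
  assume "meager M"
  then obtain N :: "nat \<Rightarrow> 'a set"
    where N: "\<And>n. closed (N n) \<and> interior (N n) = {}" and M: "M \<subseteq> (\<Union>n. N n)"
    unfolding meager_iff_subset_closed by blast
  (* Marking families by points of X needs X to be infinite, so finite X is treated directly. *)
  show "\<exists>K. sigma_compact K \<and> X \<subseteq> K \<and> meager (M + K)"
  proof (cases "finite X")
    case True
    then have "sigma_compact X"
      unfolding sigma_compact_def by (intro exI[of _ "\<lambda>_. X"]) (simp add: finite_imp_compact)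
    moreover have "meager (M + (\<Union>n::nat. X))"
      using M N True
      by (intro meager_plus_sigma_compact[of M N])
        (auto simp: interior_plus_finite_empty finite_imp_compact)
    ultimately show ?thesis
      by auto
  next
    case False
    obtain \<B> :: "'a set set" where \<B>: "countable \<B>" "\<And>b. b \<in> \<B> \<Longrightarrow> open b"
        "\<And>S. open S \<Longrightarrow> \<exists>\<U>. \<U> \<subseteq> \<B> \<and> S = \<Union>\<U>"
      using univ_second_countable by blast
    define B where "B = from_nat_into (\<B> - {{}})"
    have "\<B> - {{}} \<noteq> {}"
      using \<B>(3)[OF open_UNIV] by blast
    then have ran: "range B = \<B> - {{}}"
      unfolding B_def using \<B>(1) by (intro range_from_nat_into) auto
    have B: "open (B i) \<and> B i \<noteq> {}" for i
    proof -
      have "B i \<in> \<B> - {{}}"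
        unfolding ran[symmetric] by (rule rangeI)
      then show ?thesis
        using \<B>(2) by simp
    qed
    have base: "\<exists>i. B i \<subseteq> S" if S: "open S" "S \<noteq> {}" for S
    proof -
      obtain \<U> where "\<U> \<subseteq> \<B>" "S = \<Union>\<U>"
        using \<B>(3)[OF S(1)] by blast
      with S(2) obtain b where "b \<in> \<B> - {{}}" "b \<subseteq> S"
        by blast
      then show ?thesis
        using ran by (metis rangeE)
    qed
    define \<V> where
      "\<V> n = {V. open V \<and> (\<forall>(i, j)\<in>{..n} \<times> {..n}. \<not> B i \<subseteq> N j + closure V)}" for n
    have cover: "\<exists>V\<in>\<V> n. F \<subseteq> V" if F: "finite F" for n F
    proof -
      obtain V where "open V" "F \<subseteq> V"
          "\<And>q. q \<in> {..n} \<times> {..n} \<Longrightarrow> \<not> B (fst q) \<subseteq> N (snd q) + closure V"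
        using finite_subset_open_not_subset_plus
          [of "{..n} \<times> {..n}" F "\<lambda>q. N (snd q)" "\<lambda>q. B (fst q)"] F N B
        by auto
      then show ?thesis
        unfolding \<V>_def by fastforce
    qed
    have op: "open V" if "V \<in> \<V> n" for V n
      using that unfolding \<V>_def by blast
    obtain V \<nu> where V: "\<And>k. V k \<in> \<V> (\<nu> k)"
      and \<nu>: "filterlim \<nu> at_top sequentially"
      and ev: "\<And>x. x \<in> X \<Longrightarrow> \<forall>\<^sub>F k in sequentially. x \<in> V k"
      by (rule gamma_set_selection[where \<V> = \<V>, OF assms(2) False])
        (erule op, erule cover, rule that)
    define L where "L n = (\<Inter>k\<in>{n..}. closure (V k))" for n
    have X_L: "X \<subseteq> (\<Union>n. L n)"
    proof
      fix x assume "x \<in> X"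
      then obtain n where "\<And>k. n \<le> k \<Longrightarrow> x \<in> V k"
        using ev unfolding eventually_sequentially by blast
      then have "x \<in> L n"
        unfolding L_def by (auto intro: subsetD[OF closure_subset])
      then show "x \<in> (\<Union>n. L n)"
        by blast
    qed
    (* A basic open set B i inside N j + L n would lie in N j + closure (V k) for some k with
       i, j \<le> \<nu> k, which the choice of V k excludes. *)
    have NL: "interior (N j + L n) = {}" for j n
    proof (rule ccontr)
      assume "interior (N j + L n) \<noteq> {}"
      then obtain i where "B i \<subseteq> interior (N j + L n)"
        using base[OF open_interior] by blast
      then have i: "B i \<subseteq> N j + L n"
        using interior_subset by (rule order_trans)
      have "\<forall>\<^sub>F k in sequentially. n \<le> k \<and> max i j \<le> \<nu> k"
        using \<nu> unfolding filterlim_at_top by (intro eventually_conj eventually_ge_at_top) blast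
      then obtain k where k: "n \<le> k" "max i j \<le> \<nu> k"
        using eventually_happens'[OF sequentially_bot] by blast
      have "L n \<subseteq> closure (V k)"
        unfolding L_def using k(1) by blast
      then have "N j + L n \<subseteq> N j + closure (V k)"
        by (rule set_plus_mono2[OF order_refl])
      with i have "B i \<subseteq> N j + closure (V k)"
        by (rule order_trans)
      then show False
        using V[of k] k(2) unfolding \<V>_def by auto
    qed
    obtain C :: "nat \<Rightarrow> 'a set" where C: "\<And>l. compact (C l)" "UNIV = (\<Union>l. C l)"
      using locally_compact_sigma_compact_UNIV[OF assms(1)] unfolding sigma_compact_def by blast
    define K where "K m = L (fst (prod_decode m)) \<inter> C (snd (prod_decode m))" for m
    have K: "compact (K m)" for m
      unfolding K_def L_def using C(1) by (intro closed_Int_compact closed_INT) auto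
    have "interior (N j + K m) = {}" for j m
    proof -
      have "N j + K m \<subseteq> N j + L (fst (prod_decode m))"
        unfolding K_def by (intro set_plus_mono2) auto
      then show ?thesis
        using interior_mono[of "N j + K m"] NL by (metis subset_empty)
    qed
    then have "meager (M + (\<Union>m. K m))"
      using M N K by (intro meager_plus_sigma_compact[of M N]) auto
    moreover have "X \<subseteq> (\<Union>m. K m)"
    proof
      fix x assume "x \<in> X"
      then obtain n l where "x \<in> L n" "x \<in> C l"
        using X_L C(2) by blast
      then have "x \<in> K (prod_encode (n, l))"
        unfolding K_def by simp
      then show "x \<in> (\<Union>m. K m)"
        by blast
    qed
    ultimately show ?thesis
      unfolding sigma_compact_def using K by blast
  qed
qed

end
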